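(* For every $n\ge1$, $\operatorname{rank}(\mathcal{ODCT}_n)=n$.
   Context: $[n]=\{1,2,\ldots,n\}$ with its usual order. Maps are written on the right of their arguments. $\mathcal{ODCT}_n$ is the semigroup (under composition, $x(\alpha\beta)=(x\alpha)\beta$) of all maps $\alpha:[n]\to[n]$ that are contractions ($|x\alpha-y\alpha|\le|x-y|$ for all $x,y\in[n]$), order-preserving ($x\le y\Rightarrow x\alpha\le y\alpha$) and order-decreasing ($x\alpha\le x$ for all $x\in[n]$). For a finitely generated semigroup $S$, $\operatorname{rank}(S)=\min\{|A|: A\subseteq S,\ \langle A\rangle=S\}$, where $\langle A\rangle$ is the subsemigroup generated by $A$ (the identity map is not automatically included). *)

theory Defs
  imports Main "HOL-Library.FuncSet"
begin

inductive_set subsemigroup_generated :: "('a \<Rightarrow> 'a \<Rightarrow> 'a) \<Rightarrow> 'a set \<Rightarrow> 'a set"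
  for m :: "'a \<Rightarrow> 'a \<Rightarrow> 'a" and A :: "'a set"
where
  incl: "a \<in> A \<Longrightarrow> a \<in> subsemigroup_generated m A"
| mult: "\<lbrakk>a \<in> subsemigroup_generated m A; b \<in> subsemigroup_generated m A\<rbrakk>
    \<Longrightarrow> m a b \<in> subsemigroup_generated m A"

(* Generating sets are required to be finite because card is 0 on infinite sets. The value is
   meaningful only if S is finitely generated, as every finite semigroup is. *)
definition semigroup_rank :: "('a \<Rightarrow> 'a \<Rightarrow> 'a) \<Rightarrow> 'a set \<Rightarrow> nat" where
  "semigroup_rank m S =
    (LEAST k. \<exists>A. A \<subseteq> S \<and> finite A \<and> subsemigroup_generated m A = S \<and> card A = k)"

(* A map from {1..n} to itself is an extensional function, so that equality of maps is equality
   of their values on {1..n}. Differences are taken in int, since subtraction on nat truncates. *)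
definition ODCT :: "nat \<Rightarrow> (nat \<Rightarrow> nat) set" where
  "ODCT n = {\<alpha> \<in> {1..n} \<rightarrow>\<^sub>E {1..n}.
     (\<forall>x\<in>{1..n}. \<forall>y\<in>{1..n}. \<bar>int (\<alpha> x) - int (\<alpha> y)\<bar> \<le> \<bar>int x - int y\<bar>) \<and>
     (\<forall>x\<in>{1..n}. \<forall>y\<in>{1..n}. x \<le> y \<longrightarrow> \<alpha> x \<le> \<alpha> y) \<and>
     (\<forall>x\<in>{1..n}. \<alpha> x \<le> x)}"

(* Maps act on the right: in the product of \<alpha> and \<beta>, the left factor \<alpha> is applied first. *)
definition right_compose :: "nat \<Rightarrow> (nat \<Rightarrow> nat) \<Rightarrow> (nat \<Rightarrow> nat) \<Rightarrow> (nat \<Rightarrow> nat)" where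
  "right_compose n \<alpha> \<beta> = compose {1..n} \<beta> \<alpha>"

lemma right_compose_closed:
  assumes "\<alpha> \<in> ODCT n" "\<beta> \<in> ODCT n"
  shows "right_compose n \<alpha> \<beta> \<in> ODCT n"
proof -
  have r: "\<alpha> x \<in> {1..n}" if "x \<in> {1..n}" for x
    using assms(1) that unfolding ODCT_def by blast
  have c: "right_compose n \<alpha> \<beta> x = \<beta> (\<alpha> x)" if "x \<in> {1..n}" for x
    using that by (simp add: right_compose_def compose_eq)
  have "right_compose n \<alpha> \<beta> \<in> {1..n} \<rightarrow>\<^sub>E {1..n}"
    using assms unfolding ODCT_def right_compose_def by (auto simp: compose_def)
  moreover have "\<bar>int (\<beta> (\<alpha> x)) - int (\<beta> (\<alpha> y))\<bar> \<le> \<bar>int x - int y\<bar>"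
    if "x \<in> {1..n}" "y \<in> {1..n}" for x y
  proof -
    have "\<bar>int (\<beta> (\<alpha> x)) - int (\<beta> (\<alpha> y))\<bar> \<le> \<bar>int (\<alpha> x) - int (\<alpha> y)\<bar>"
      using assms(2) r[OF that(1)] r[OF that(2)] unfolding ODCT_def by blast
    also have "\<dots> \<le> \<bar>int x - int y\<bar>"
      using assms(1) that unfolding ODCT_def by blast
    finally show ?thesis .
  qed
  moreover have "\<beta> (\<alpha> x) \<le> \<beta> (\<alpha> y)" if "x \<in> {1..n}" "y \<in> {1..n}" "x \<le> y" for x y
    using assms r[OF that(1)] r[OF that(2)] that unfolding ODCT_def by blast
  moreover have "\<beta> (\<alpha> x) \<le> x" if "x \<in> {1..n}" for x
  proof -
    have "\<beta> (\<alpha> x) \<le> \<alpha> x" using assms(2) r[OF that] unfolding ODCT_def by blast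
    also have "\<dots> \<le> x" using assms(1) that unfolding ODCT_def by blast
    finally show ?thesis .
  qed
  ultimately show ?thesis by (simp add: ODCT_def c del: atLeastAtMost_iff)
qed

lemma right_compose_assoc:
  assumes "\<alpha> \<in> ODCT n"
  shows "right_compose n (right_compose n \<alpha> \<beta>) \<gamma> =
    right_compose n \<alpha> (right_compose n \<beta> \<gamma>)"
proof -
  have "\<alpha> \<in> {1..n} \<rightarrow> {1..n}" using assms by (auto simp: ODCT_def)
  then show ?thesis unfolding right_compose_def by (rule compose_assoc)
qed

end

theory Submission imports Defs begin

text \<open>
  An order-preserving contraction rises by 0 or 1 from each point to the next, and an
  order-decreasing one starts at 1. So an element of \<^term>\<open>ODCT n\<close> is determined by the set of
  points \<open>x < n\<close> at which it is flat, that is, takes the same value at \<open>x\<close> and at \<open>Suc x\<close>.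
  The generators are the identity and the \<open>n - 1\<close> maps with exactly one flat point.

  They generate (\<open>ODCT_generated_by_merges\<close>): a map \<open>\<alpha>\<close> that is flat at \<open>i\<close> factors through
  the map that merges \<open>i\<close> with \<open>Suc i\<close>. The second factor is free at \<open>n\<close>, which the merging
  map does not hit. If it rises there, it ends one higher than \<open>\<alpha>\<close> did, so the process stops,
  and it can stop only at the map without flat points.

  They are all needed (\<open>merge_irreducible\<close>): a flat point of the first factor of a product is a
  flat point of the product. Hence the first factor of a product with at most one flat point is
  the identity, in which case the second factor is the product, or is the product itself. So a
  generator belongs to every generating set.
\<close>

definition flats :: "nat \<Rightarrow> (nat \<Rightarrow> nat) \<Rightarrow> nat set" where
  "flats n \<alpha> = {x. 1 \<le> x \<and> x < n \<and> \<alpha> (Suc x) = \<alpha> x}"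

text \<open>For \<open>i < n\<close> this map is flat at \<open>i\<close> only; the value \<open>i = n\<close> gives the identity, so that
  the indices \<open>1\<close> to \<open>n\<close> enumerate all the generators.\<close>

definition merge :: "nat \<Rightarrow> nat \<Rightarrow> nat \<Rightarrow> nat" where
  "merge n i = (\<lambda>x\<in>{1..n}. if x \<le> i then x else x - 1)"

lemma right_compose_apply:
  "x \<in> {1..n} \<Longrightarrow> right_compose n \<alpha> \<beta> x = \<beta> (\<alpha> x)"
  by (simp add: right_compose_def compose_eq)

lemma right_compose_extensional: "right_compose n \<alpha> \<beta> \<in> extensional {1..n}"
  by (simp add: right_compose_def)

lemma ODCT_extensional: "\<alpha> \<in> ODCT n \<Longrightarrow> \<alpha> \<in> extensional {1..n}"
  by (auto simp: ODCT_def PiE_def)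

lemma ODCT_range: "\<alpha> \<in> ODCT n \<Longrightarrow> x \<in> {1..n} \<Longrightarrow> \<alpha> x \<in> {1..n}"
  unfolding ODCT_def by blast

lemma ODCT_at_1:
  assumes "\<alpha> \<in> ODCT n" "1 \<le> n"
  shows "\<alpha> 1 = 1"
proof -
  have "1 \<in> {1..n}" using assms(2) by simp
  then have "\<alpha> 1 \<le> 1" "\<alpha> 1 \<in> {1..n}"
    using assms(1) unfolding ODCT_def by blast+
  then show ?thesis by simp
qed

lemma ODCT_Suc:
  assumes "\<alpha> \<in> ODCT n" "1 \<le> x" "x < n"
  shows "\<alpha> (Suc x) = \<alpha> x \<or> \<alpha> (Suc x) = Suc (\<alpha> x)"
proof -
  have x: "x \<in> {1..n}" "Suc x \<in> {1..n}" using assms by auto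
  then have "\<bar>int (\<alpha> (Suc x)) - int (\<alpha> x)\<bar> \<le> \<bar>int (Suc x) - int x\<bar>"
    using assms(1) unfolding ODCT_def by blast
  moreover have "\<alpha> x \<le> \<alpha> (Suc x)"
    using assms(1) x le_SucI[OF order_refl] unfolding ODCT_def by blast
  ultimately show ?thesis by linarith
qed

text \<open>Local steps of 0 or 1 from the value 1 force all three global conditions; this reduces
  membership to a check at neighbouring points.\<close>

lemma ODCT_I:
  assumes ext: "\<alpha> \<in> extensional {1..n}"
    and one: "1 \<le> n \<Longrightarrow> \<alpha> 1 = 1"
    and step: "\<And>x. 1 \<le> x \<Longrightarrow> x < n \<Longrightarrow> \<alpha> (Suc x) = \<alpha> x \<or> \<alpha> (Suc x) = Suc (\<alpha> x)"
  shows "\<alpha> \<in> ODCT n"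
proof -
  have between: "\<alpha> x \<le> \<alpha> y \<and> \<alpha> y + x \<le> \<alpha> x + y" if "1 \<le> x" "x \<le> y" "y \<le> n" for x y
    using that(2,3)
  proof (induction y rule: dec_induct)
    case (step y)
    then show ?case using assms(3)[of y] that(1) by fastforce
  qed simp
  have contr: "\<bar>int (\<alpha> x) - int (\<alpha> y)\<bar> \<le> \<bar>int x - int y\<bar>"
    if "x \<in> {1..n}" "y \<in> {1..n}" for x y
    using between[of x y] between[of y x] that by (cases "x \<le> y") auto
  have bounds: "1 \<le> \<alpha> x \<and> \<alpha> x \<le> x" if "x \<in> {1..n}" for x
    using between[of 1 x] one that by auto
  have "\<alpha> x \<in> {1..n}" if "x \<in> {1..n}" for x
    using bounds[OF that] that by auto
  then have "\<alpha> \<in> {1..n} \<rightarrow>\<^sub>E {1..n}"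
    using ext by (simp add: PiE_iff)
  then show ?thesis
    using contr between bounds by (simp add: ODCT_def)
qed

lemma ODCT_eqI_flats:
  assumes "\<alpha> \<in> ODCT n" "\<beta> \<in> ODCT n" "flats n \<alpha> = flats n \<beta>"
  shows "\<alpha> = \<beta>"
proof (rule extensionalityI[OF ODCT_extensional ODCT_extensional])
  show "\<alpha> x = \<beta> x" if "x \<in> {1..n}" for x
  proof -
    have "1 \<le> x" "x \<le> n" using that by auto
    then show ?thesis
    proof (induction x rule: dec_induct)
      case base
      then show ?case using ODCT_at_1[OF assms(1)] ODCT_at_1[OF assms(2)] by simp
    next
      case (step x)
      then have "x \<in> flats n \<alpha> \<longleftrightarrow> x \<in> flats n \<beta>" using assms(3) by simp
      then show ?case
        using step ODCT_Suc[OF assms(1), of x] ODCT_Suc[OF assms(2), of x]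
        by (auto simp: flats_def)
    qed
  qed
qed (use assms in auto)

lemma merge_in_ODCT: "1 \<le> i \<Longrightarrow> merge n i \<in> ODCT n"
  by (rule ODCT_I) (auto simp: merge_def)

lemma flats_merge: "1 \<le> i \<Longrightarrow> flats n (merge n i) = {i} \<inter> {..<n}"
  by (auto simp: flats_def merge_def split: if_splits)

lemma merge_identity: "\<alpha> \<in> ODCT n \<Longrightarrow> right_compose n (merge n n) \<alpha> = \<alpha>"
  by (rule extensionalityI[OF right_compose_extensional ODCT_extensional])
    (auto simp: right_compose_apply merge_def)

lemma inj_on_merge: "inj_on (merge n) {1..n}"
proof (rule linorder_inj_onI)
  fix i j assume "i < j" "i \<in> {1..n}" "j \<in> {1..n}"
  then have "merge n i (Suc i) \<noteq> merge n j (Suc i)" by (auto simp: merge_def)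
  then show "merge n i \<noteq> merge n j" by metis
qed auto

lemma flats_right_compose: "flats n \<alpha> \<subseteq> flats n (right_compose n \<alpha> \<beta>)"
  by (auto simp: flats_def right_compose_apply)

lemma merge_irreducible:
  assumes "\<alpha> \<in> ODCT n" "\<beta> \<in> ODCT n" "i \<in> {1..n}"
    and eq: "right_compose n \<alpha> \<beta> = merge n i"
  shows "\<alpha> = merge n i \<or> \<beta> = merge n i"
proof -
  have i: "1 \<le> i" "1 \<le> n" using assms(3) by auto
  have "flats n \<alpha> \<subseteq> {i} \<inter> {..<n}"
    using flats_right_compose[of n \<alpha> \<beta>] flats_merge[OF i(1)] eq by simp
  then consider "flats n \<alpha> = {}" | "flats n \<alpha> = {i} \<inter> {..<n}" by blast
  then show ?thesis
  proof cases
    case 1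
    then have "\<alpha> = merge n n"
      using ODCT_eqI_flats[OF assms(1) merge_in_ODCT] flats_merge i by simp
    then show ?thesis using merge_identity[OF assms(2)] eq by simp
  next
    case 2
    then show ?thesis
      using ODCT_eqI_flats[OF assms(1) merge_in_ODCT] flats_merge i by simp
  qed
qed

text \<open>One flat point is split off. Prescribing a rise at \<open>n\<close> for the second factor makes its
  last value exceed that of \<open>\<alpha>\<close>; this is what drives the induction below.\<close>

lemma ODCT_factor_merge:
  assumes \<alpha>: "\<alpha> \<in> ODCT n" and i: "i \<in> flats n \<alpha>"
  obtains \<beta> where "\<beta> \<in> ODCT n" "\<beta> n = Suc (\<alpha> n)" "\<alpha> = right_compose n (merge n i) \<beta>"
proof -
  have i: "1 \<le> i" "i < n" "\<alpha> (Suc i) = \<alpha> i" using i by (auto simp: flats_def)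
  define \<beta> where "\<beta> = (\<lambda>x\<in>{1..n}. if x < i then \<alpha> x else if x < n then \<alpha> (Suc x) else Suc (\<alpha> n))"
  have "\<beta> \<in> ODCT n"
  proof (rule ODCT_I)
    show "\<beta> \<in> extensional {1..n}" by (simp add: \<beta>_def)
    show "\<beta> 1 = 1"
      using i ODCT_at_1[OF \<alpha>] by (cases "i = 1") (auto simp: \<beta>_def)
    fix x assume x: "1 \<le> x" "x < n"
    consider "Suc x < i" | "Suc x = i" | "i \<le> x" "Suc x < n" | "i \<le> x" "Suc x = n"
      using x by linarith
    then show "\<beta> (Suc x) = \<beta> x \<or> \<beta> (Suc x) = Suc (\<beta> x)"
      using x i ODCT_Suc[OF \<alpha>, of x] ODCT_Suc[OF \<alpha>, of "Suc x"] by cases (auto simp: \<beta>_def)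
  qed
  moreover have "\<beta> n = Suc (\<alpha> n)" using i by (simp add: \<beta>_def)
  moreover have "\<alpha> = right_compose n (merge n i) \<beta>"
  proof (rule extensionalityI[OF ODCT_extensional[OF \<alpha>]])
    show "right_compose n (merge n i) \<beta> \<in> extensional {1..n}"
      by (rule right_compose_extensional)
    fix x assume x: "x \<in> {1..n}"
    consider "x < i" | "x = i" | "i < x" by linarith
    then show "\<alpha> x = right_compose n (merge n i) \<beta> x"
      using x i by cases (auto simp: right_compose_apply merge_def \<beta>_def)
  qed
  ultimately show thesis by (rule that)
qed

lemma ODCT_generated_by_merges:
  assumes "1 \<le> n" "\<alpha> \<in> ODCT n"
  shows "\<alpha> \<in> subsemigroup_generated (right_compose n) (merge n ` {1..n})"
  using assms(2)
proof (induction "n - \<alpha> n" arbitrary: \<alpha> rule: less_induct)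
  case less
  show ?case
  proof (cases "flats n \<alpha> = {}")
    case True
    then have "\<alpha> = merge n n"
      using ODCT_eqI_flats[OF less.prems merge_in_ODCT] flats_merge assms(1) by simp
    then show ?thesis using assms(1) by (auto intro: subsemigroup_generated.incl)
  next
    case False
    then obtain i where i: "i \<in> flats n \<alpha>" by blast
    then have "i \<in> {1..n}" by (simp add: flats_def)
    obtain \<beta> where \<beta>: "\<beta> \<in> ODCT n" "\<beta> n = Suc (\<alpha> n)" "\<alpha> = right_compose n (merge n i) \<beta>"
      using ODCT_factor_merge[OF less.prems i] .
    have "\<beta> n \<le> n" using ODCT_range[OF \<beta>(1), of n] assms(1) by simp
    then have "n - \<beta> n < n - \<alpha> n" using \<beta>(2) by simp
    then have "\<beta> \<in> subsemigroup_generated (right_compose n) (merge n ` {1..n})"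
      using less.hyps \<beta>(1) by blast
    then show ?thesis
      using \<open>i \<in> {1..n}\<close> by (subst \<beta>(3)) (blast intro: subsemigroup_generated.intros)
  qed
qed

lemma subsemigroup_generated_subset:
  assumes "A \<subseteq> S" "\<And>a b. a \<in> S \<Longrightarrow> b \<in> S \<Longrightarrow> m a b \<in> S"
  shows "subsemigroup_generated m A \<subseteq> S"
proof
  fix x assume "x \<in> subsemigroup_generated m A"
  then show "x \<in> S" by induction (use assms in auto)
qed

lemma irreducible_in_generators:
  assumes "g \<in> subsemigroup_generated m A"
    and irred: "\<And>a b. a \<in> subsemigroup_generated m A \<Longrightarrow> b \<in> subsemigroup_generated m A
      \<Longrightarrow> m a b = g \<Longrightarrow> a = g \<or> b = g"
  shows "g \<in> A"
proof -
  have "x = g \<longrightarrow> g \<in> A" if "x \<in> subsemigroup_generated m A" for x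
    using that by induction (use irred in auto)
  then show ?thesis using assms(1) by blast
qed

theorem theorem21:
  fixes n :: nat
  assumes "n \<ge> 1"
  shows "semigroup_rank (right_compose n) (ODCT n) = n"
  unfolding semigroup_rank_def
proof (rule Least_equality)
  let ?G = "merge n ` {1..n}"
  have G: "?G \<subseteq> ODCT n" using merge_in_ODCT by auto
  moreover have "subsemigroup_generated (right_compose n) ?G = ODCT n"
    using subsemigroup_generated_subset[OF G, of "right_compose n"] right_compose_closed
      ODCT_generated_by_merges[OF assms] by blast
  moreover have "card ?G = n" using card_image[OF inj_on_merge] by simp
  ultimately show "\<exists>A. A \<subseteq> ODCT n \<and> finite A
      \<and> subsemigroup_generated (right_compose n) A = ODCT n \<and> card A = n"
    by blast
next
  fix k
  assume "\<exists>A. A \<subseteq> ODCT n \<and> finite A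
      \<and> subsemigroup_generated (right_compose n) A = ODCT n \<and> card A = k"
  then obtain A where A: "finite A" "card A = k"
    and gen: "subsemigroup_generated (right_compose n) A = ODCT n"
    by blast
  have "merge n ` {1..n} \<subseteq> A"
  proof
    fix g assume "g \<in> merge n ` {1..n}"
    then obtain i where i: "i \<in> {1..n}" "g = merge n i" by blast
    have "g \<in> ODCT n" using i merge_in_ODCT by simp
    then show "g \<in> A"
      using irreducible_in_generators[of g "right_compose n" A] merge_irreducible i gen by metis
  qed
  then have "card (merge n ` {1..n}) \<le> k" using card_mono A by blast
  then show "n \<le> k" using card_image[OF inj_on_merge] by simp
qed

end
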